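(* Let $\mathbf{P}=(P_1,\ldots,P_n)^\top:\mathbb{R}^n\to\mathbb{R}^n$ be a polynomial map, where each $P_i$ is a homogeneous polynomial of degree $d\ge1$ with nonnegative coefficients, and assume that $\mathbf{P}$ is weakly primitive. Let $\psi\in\mathbb{R}^n$ be a vector with all coordinates positive, and let $\mathbf{F}=(F_1,\ldots,F_n)^\top$ with $F_i(\mathbf{x})=(P_i(\mathbf{x}))^{1/d}$. Let $\lambda$ be the unique scalar for which there is a positive vector $\mathbf{u}$ with $P_i(\mathbf{u})=\lambda u_i^d$ for all $i\in[n]$, and let $\mathbf{u}\in\operatorname{int}\mathbb{R}_+^n$ be the unique such vector satisfying $\psi^\top\mathbf{u}=1$. Let $M:=\mathbf{F}'(\mathbf{u})$ be the Jacobian matrix of $\mathbf{F}$ at $\mathbf{u}$, and let $r$ denote the maximal modulus of the eigenvalues of $M$ distinct from $\lambda$. For an arbitrary $\mathbf{x}^{(0)}\in\operatorname{int}\mathbb{R}_+^n$, let the sequence $\mathbf{x}^{(k)}$ be produced by the power algorithm $$\mathbf{x}^{(k+1)}=\big(\psi^\top\mathbf{F}(\mathbf{x}^{(k)})\big)^{-1}\mathbf{F}(\mathbf{x}^{(k)}),\qquad k=0,1,2,\ldots$$ Then $$\limsup_{k\to\infty}\|\mathbf{x}^{(k)}-\mathbf{u}\|^{1/k}\le \lambda^{-1}r .$$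
   Context: $[n]=\{1,\ldots,n\}$; $\operatorname{int}\mathbb{R}_+^n$ is the set of vectors with all coordinates positive; $\|\cdot\|$ is a norm on $\mathbb{R}^n$. The di-graph $G(\mathbf{P})$ (for $P_i$ homogeneous) has vertex set $[n]$, and $(i,j)$ is a di-edge if and only if the variable $x_j$ effectively appears in $P_i$ (in a monomial with nonzero coefficient). $\mathbf{P}$ is weakly primitive if $G(\mathbf{P})$ is strongly connected and the gcd of the lengths of its circuits is equal to one.
   Formalization: For d≥2 the claim with λ (P_i(u)=λu_i^d) is false, e.g. P=(c(2x²+y²), c(x²+2y²)) with c>3; λ is replaced by μ=λ^{1/d}, the eigenvalue of F at u, both in "eigenvalues of M distinct from λ" and in the bound, now μ^{-1}r. *)

theory Defs
  imports
    "HOL-Analysis.Analysis"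
    "HOL-Library.Poly_Mapping"
    "Graph_Theory.Digraph_Component"
    "Graph_Theory.Pair_Digraph"
begin

text \<open>
  A polynomial in variables indexed by \<open>'n\<close> is a finitely supported map from exponent vectors
  to coefficients. The index set \<open>[n]\<close> is the type \<open>'n\<close>.
\<close>

type_synonym 'n mpoly = "('n \<Rightarrow>\<^sub>0 nat) \<Rightarrow>\<^sub>0 real"

definition mpoly_eval :: "'n::finite mpoly \<Rightarrow> real ^ 'n \<Rightarrow> real" where
  "mpoly_eval p x =
     (\<Sum>m\<in>Poly_Mapping.keys p. Poly_Mapping.lookup p m * (\<Prod>j\<in>UNIV. x $ j ^ Poly_Mapping.lookup m j))"

definition mpoly_homogeneous :: "nat \<Rightarrow> 'n::finite mpoly \<Rightarrow> bool" where
  "mpoly_homogeneous d p \<longleftrightarrow>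
     (\<forall>m\<in>Poly_Mapping.keys p. (\<Sum>j\<in>UNIV. Poly_Mapping.lookup m j) = d)"

definition mpoly_nonneg :: "'n mpoly \<Rightarrow> bool" where
  "mpoly_nonneg p \<longleftrightarrow> (\<forall>m. 0 \<le> Poly_Mapping.lookup p m)"

definition mpoly_vars :: "'n mpoly \<Rightarrow> 'n set" where
  "mpoly_vars p = (\<Union>m\<in>Poly_Mapping.keys p. Poly_Mapping.keys m)"

definition poly_digraph :: "('n \<Rightarrow> 'n mpoly) \<Rightarrow> 'n pair_pre_digraph" where
  "poly_digraph P = \<lparr> pverts = UNIV, parcs = {(i, j). j \<in> mpoly_vars (P i)} \<rparr>"

text \<open>
  Circuits are the elementary directed cycles, loops included; allowing repeated vertices
  would not change the gcd.
\<close>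

definition weakly_primitive :: "('n \<Rightarrow> 'n mpoly) \<Rightarrow> bool" where
  "weakly_primitive P \<longleftrightarrow>
     strongly_connected (with_proj (poly_digraph P)) \<and>
     Gcd (length ` {p. pre_digraph.cycle (with_proj (poly_digraph P)) p}) = 1"

definition pos_vec :: "real ^ 'n \<Rightarrow> bool" where
  "pos_vec x \<longleftrightarrow> (\<forall>i. 0 < x $ i)"

definition root_map :: "nat \<Rightarrow> ('n::finite \<Rightarrow> 'n mpoly) \<Rightarrow> real ^ 'n \<Rightarrow> real ^ 'n" where
  "root_map d P x = (\<chi> i. root d (mpoly_eval (P i) x))"

text \<open>Eigenvalues of a real matrix are taken over the complex numbers.\<close>

definition complex_eigenvalues :: "real ^ 'n ^ 'n \<Rightarrow> complex set" where
  "complex_eigenvalues A =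
     {z. \<exists>v. v \<noteq> 0 \<and> map_matrix complex_of_real A *v v = z *s v}"

text \<open>
  The maximal modulus of the eigenvalues of \<open>A\<close> distinct from \<open>\<mu>\<close>. Inserting \<open>0\<close> fixes the value
  \<open>0\<close> when there are none, as for a one by one matrix, and is harmless otherwise.
\<close>

definition max_modulus_except :: "real ^ 'n ^ 'n \<Rightarrow> real \<Rightarrow> real" where
  "max_modulus_except A \<mu> =
     Max (insert 0 (cmod ` (complex_eigenvalues A - {complex_of_real \<mu>})))"

definition is_norm :: "('a::real_vector \<Rightarrow> real) \<Rightarrow> bool" where
  "is_norm N \<longleftrightarrow>
     (\<forall>x. 0 \<le> N x) \<and> (\<forall>x. N x = 0 \<longleftrightarrow> x = 0) \<and>
     (\<forall>c x. N (c *\<^sub>R x) = \<bar>c\<bar> * N x) \<and> (\<forall>x y. N (x + y) \<le> N x + N y)"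

definition power_algorithm ::
  "real ^ 'n \<Rightarrow> (real ^ 'n \<Rightarrow> real ^ 'n) \<Rightarrow> (nat \<Rightarrow> real ^ 'n) \<Rightarrow> bool" where
  "power_algorithm \<psi> F x \<longleftrightarrow>
     (\<forall>k. x (Suc k) = inverse (\<psi> \<bullet> F (x k)) *\<^sub>R F (x k))"

text \<open>
  The eigenvalue condition \<open>P\<^sub>i(u) = \<lambda> u\<^sub>i\<^sup>d\<close> says that \<open>u\<close> is an eigenvector of
  \<open>F = root_map d P\<close> for \<open>\<mu> = root d \<lambda>\<close>, not for \<open>\<lambda>\<close>. By Euler's identity \<open>\<mu>\<close> is the Perron
  eigenvalue of the Jacobian matrix of \<open>F\<close> at \<open>u\<close>. It is therefore \<open>\<mu>\<close> that has to be excluded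
  from the spectrum and that normalises the convergence rate; \<open>\<mu> = \<lambda>\<close> if \<open>d = 1\<close>.
\<close>

end

theory Submission
  imports Defs "HOL-Computational_Algebra.Fundamental_Theorem_Algebra"
begin

text \<open>
  Up to positive factors the algorithm iterates \<open>G = F / \<mu>\<close>, a monotone, homogeneous map fixing \<open>u\<close>.
  Primitivity of the graph forces the orbits of \<open>G\<close> to converge to multiples of \<open>u\<close>, so the
  algorithm converges to \<open>u\<close>, and the rate is governed by the derivative
  \<open>h \<mapsto> (M h - (\<psi> \<bullet> M h) u) / \<mu>\<close> of the normalized map at \<open>u\<close>. The nonzero eigenvalues of this
  operator are those of \<open>M / \<mu>\<close> other than the simple eigenvalue \<open>1\<close>. That powers of an operator grow
  no faster than the eigenvalues allow is shown by induction on the degree of an annihilating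
  polynomial, splitting off one linear factor at a time.
\<close>

subsection \<open>Primitive digraphs\<close>

text \<open>The linearization at \<open>u\<close> controls only iterates already close to
  \<open>u\<close>, so convergence has to come first. It comes from order: the largest multiple of
  \<open>u\<close> below a positive vector never decreases under \<open>G\<close>. As
  \<open>G\<close> is homogeneous of degree one, normalizing after every step or once at the end
  gives the same vector, which carries convergence over from \<open>G\<close> to the algorithm. The
  normalized derivative kills \<open>u\<close>, because \<open>M u = \<mu> u\<close> and
  \<open>\<psi> \<bullet> u = 1\<close>; so the eigenvalue 1 turns into 0. Since r leaves out only
  the value \<mu>, whatever its multiplicity, \<mu> must have no second independent eigenvector and
  no generalized one. Both facts come from strong connectivity. Eigenvalues of modulus r may have
  Jordan blocks, so every estimate is made for some q > r / \<mu>; the k-th root and the limsup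
  remove the constant and the excess.\<close>

text \<open>Let e be the least positive difference of two elements of \<open>S\<close>. It divides
  each s in \<open>S\<close>, since otherwise \<open>s mod e\<close> would be a smaller difference.
  Hence e = 1 and \<open>S\<close> contains some b and b + 1. For n >= b * b > 0 the quotient by b
  is at least the remainder, so n is a sum of copies of b and b + 1.\<close>

lemma numerical_semigroup_cofinite:
  fixes S :: "nat set"
  assumes zero: "0 \<in> S" and add: "\<And>a b. a \<in> S \<Longrightarrow> b \<in> S \<Longrightarrow> a + b \<in> S"
    and gcd: "Gcd S = 1"
  shows "\<exists>N. \<forall>n\<ge>N. n \<in> S"
proof -
  have mult: "k * a \<in> S" if "a \<in> S" for k a
    using that by (induction k) (auto intro: zero add)
  define D where "D e \<longleftrightarrow> 0 < e \<and> (\<exists>b\<in>S. b + e \<in> S)" for e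
  have "\<exists>e. D e"
  proof (rule ccontr)
    assume "\<nexists>e. D e"
    then have "\<forall>a\<in>S. a = 0" using zero by (force simp: D_def)
    then have "Gcd S = 0" by (auto simp: Gcd_0_iff)
    with gcd show False by simp
  qed
  define e where "e = (LEAST e. D e)"
  have De: "D e" unfolding e_def using \<open>\<exists>e. D e\<close> by (rule LeastI_ex)
  then obtain b where b: "b \<in> S" "b + e \<in> S" and e0: "0 < e" by (auto simp: D_def)
  have "e dvd s" if s: "s \<in> S" for s
  proof (rule ccontr)
    assume "\<not> e dvd s"
    then have t: "0 < s mod e" by (simp add: mod_greater_zero_iff_not_dvd)
    have "(s div e) * (b + e) + s mod e = (s div e) * b + s"
      by (simp add: algebra_simps)
    moreover have "(s div e) * b + s \<in> S" using b s by (intro add mult)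
    ultimately have "D (s mod e)" unfolding D_def
      using t mult[OF b(2), of "s div e"]
      by (intro conjI bexI[of _ "(s div e) * (b + e)"]) auto
    then have "e \<le> s mod e" unfolding e_def by (rule Least_le)
    with e0 show False by (metis leD mod_less_divisor)
  qed
  then have "e dvd Gcd S" by (rule Gcd_greatest)
  with gcd have e1: "e = 1" by simp
  have "n \<in> S" if n: "n \<ge> b * b" for n
  proof (cases "b = 0")
    case True
    with b e1 mult[of 1 n] show ?thesis by simp
  next
    case False
    have "n mod b < b" using False by simp
    moreover have "b \<le> n div b" using n False by (simp add: less_eq_div_iff_mult_less_eq)
    ultimately have le: "n mod b \<le> n div b" by simp
    have "(n div b - n mod b) * b + (n mod b) * (b + 1) = n"
    proof -
      have "(n div b - n mod b) * b + (n mod b) * (b + 1)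
          = ((n div b - n mod b) + n mod b) * b + n mod b"
        by (simp only: algebra_simps)
      also have "\<dots> = n" using le by simp
      finally show ?thesis .
    qed
    moreover have "(n div b - n mod b) * b + (n mod b) * (b + 1) \<in> S"
      by (intro add mult[OF b(1)] mult[OF b(2)[unfolded e1]])
    ultimately show ?thesis by simp
  qed
  then show ?thesis by blast
qed

text \<open>The lengths of closed walks at i form an additive semigroup. Going from i to v and back,
  with and without the closed walk of length l at v, gives two lengths that differ by l, so their
  gcd divides all of \<open>L\<close>. Closed walks of every large length at i, continued by one
  fixed walk to j, reach j in every large length, and the finitely many pairs share one m.\<close>

lemma primitive_relpow:
  fixes R :: "'a::finite rel"
  assumes conn: "R\<^sup>* = UNIV" and gcd: "Gcd L = 1" and L: "\<And>l. l \<in> L \<Longrightarrow> \<exists>v. (v, v) \<in> R ^^ l"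
  shows "\<exists>m. \<forall>i j. (i, j) \<in> R ^^ m"
proof -
  have path: "\<exists>p. (i, j) \<in> R ^^ p" for i j
    using conn rtrancl_imp_relpow[of "(i, j)" R] by auto
  have comp: "(i, k) \<in> R ^^ (a + b)" if "(i, j) \<in> R ^^ a" "(j, k) \<in> R ^^ b" for i j k a b
    using that by (auto simp: relpow_add)
  have loops: "\<exists>N. \<forall>n\<ge>N. (i, i) \<in> R ^^ n" for i
  proof -
    let ?S = "{n. (i, i) \<in> R ^^ n}"
    have "Gcd ?S dvd l" if "l \<in> L" for l
    proof -
      obtain v where v: "(v, v) \<in> R ^^ l" using L \<open>l \<in> L\<close> by blast
      obtain p q where pq: "(i, v) \<in> R ^^ p" "(v, i) \<in> R ^^ q" using path by meson
      have "Gcd ?S dvd p + q" "Gcd ?S dvd p + l + q"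
        using comp[OF pq] comp[OF comp[OF pq(1) v] pq(2)] by auto
      then have "Gcd ?S dvd (p + l + q) - (p + q)" by (intro dvd_diff_nat)
      then show ?thesis by simp
    qed
    then have "Gcd ?S dvd Gcd L" by (rule Gcd_greatest)
    with gcd have "Gcd ?S = 1" by simp
    then have "\<exists>N. \<forall>n\<ge>N. n \<in> ?S"
      by (intro numerical_semigroup_cofinite) (auto intro: comp)
    then show ?thesis by simp
  qed
  have "\<exists>N. \<forall>n\<ge>N. (i, j) \<in> R ^^ n" for i j
  proof -
    obtain N p where N: "\<forall>n\<ge>N. (i, i) \<in> R ^^ n" and p: "(i, j) \<in> R ^^ p"
      using loops path by meson
    have "(i, j) \<in> R ^^ n" if "n \<ge> N + p" for n
      using comp[of i i "n - p" j p] N p that by auto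
    then show ?thesis by blast
  qed
  then obtain N where N: "\<And>i j n. n \<ge> N i j \<Longrightarrow> (i, j) \<in> R ^^ n" by metis
  define m where "m = (\<Sum>i\<in>UNIV. \<Sum>j\<in>UNIV. N i j)"
  have "N i j \<le> m" for i j
  proof -
    have "N i j \<le> (\<Sum>j\<in>UNIV. N i j)" by (rule member_le_sum) auto
    also have "\<dots> \<le> m" unfolding m_def by (rule member_le_sum) auto
    finally show ?thesis .
  qed
  with N show ?thesis by blast
qed

text \<open>As a plain relation, the graph has its walks of length k in
  \<open>arc_rel P ^^ k\<close>.\<close>

definition arc_rel :: "('n \<Rightarrow> 'n mpoly) \<Rightarrow> 'n rel" where
  "arc_rel P = {(i, j). j \<in> mpoly_vars (P i)}"

lemma cas_relpow:
  assumes "pre_digraph.cas (with_proj G) u p v" "set p \<subseteq> parcs G"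
  shows "(u, v) \<in> parcs G ^^ length p"
  using assms
proof (induction p arbitrary: u)
  case Nil
  then show ?case by (simp add: pre_digraph.cas.simps)
next
  case (Cons e p)
  then show ?case
    by (cases e) (auto intro: relpow_Suc_I2 simp: pre_digraph.cas.simps simp del: relpow.simps)
qed

lemma weakly_primitive_relpow:
  fixes P :: "'n::finite \<Rightarrow> 'n mpoly"
  assumes "weakly_primitive P"
  shows "(arc_rel P)\<^sup>* = UNIV" and "\<exists>m. \<forall>i j. (i, j) \<in> arc_rel P ^^ m"
proof -
  let ?G = "poly_digraph P"
  have arcs: "parcs ?G = arc_rel P" "pverts ?G = UNIV"
    by (auto simp: poly_digraph_def arc_rel_def)
  have "(i, j) \<in> (arc_rel P)\<^sup>*" for i j
  proof -
    have "reachable (with_proj ?G) i j"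
      using assms arcs by (auto simp: weakly_primitive_def strongly_connected_def)
    then show ?thesis using reachable_rtranclI[of "with_proj ?G" i j] arcs by simp
  qed
  then show *: "(arc_rel P)\<^sup>* = UNIV" by auto
  show "\<exists>m. \<forall>i j. (i, j) \<in> arc_rel P ^^ m"
  proof (rule primitive_relpow[OF *])
    show "Gcd (length ` {p. pre_digraph.cycle (with_proj ?G) p}) = 1"
      using assms by (simp add: weakly_primitive_def)
    show "\<exists>v. (v, v) \<in> arc_rel P ^^ l"
      if "l \<in> length ` {p. pre_digraph.cycle (with_proj ?G) p}" for l
    proof -
      obtain p v where "pre_digraph.awalk (with_proj ?G) v p v" and l: "l = length p"
        using \<open>l \<in> _\<close> by (auto simp: pre_digraph.cycle_def)
      then show ?thesis
        using cas_relpow[of ?G v p v] arcs by (auto simp: pre_digraph.awalk_def)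
    qed
  qed
qed

text \<open>A single vertex without loop is strongly connected, so the gcd has to supply the arc:
  being nonzero, it yields a closed walk of positive length at some v. A vertex i without outgoing
  arc reaches only itself, so v = i, and the walk would leave i. The lemma keeps each
  \<open>P i\<close> from being zero.\<close>

lemma weakly_primitive_has_arc:
  fixes P :: "'n::finite \<Rightarrow> 'n mpoly"
  assumes "weakly_primitive P"
  shows "\<exists>j. (i, j) \<in> arc_rel P"
proof (rule ccontr)
  assume no: "\<nexists>j. (i, j) \<in> arc_rel P"
  have "\<exists>l\<in>length ` {p. pre_digraph.cycle (with_proj (poly_digraph P)) p}. l \<noteq> 0"
    using assms unfolding weakly_primitive_def
    by (metis Gcd_0_iff One_nat_def insertI1 subsetI zero_neq_one)
  then obtain p v where p: "pre_digraph.awalk (with_proj (poly_digraph P)) v p v" "length p \<noteq> 0"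
    by (auto simp: pre_digraph.cycle_def)
  then have "(v, v) \<in> arc_rel P ^^ length p"
    using cas_relpow[of "poly_digraph P" v p v]
    by (auto simp: pre_digraph.awalk_def poly_digraph_def arc_rel_def)
  moreover have "(i, v) \<in> (arc_rel P)\<^sup>*" using weakly_primitive_relpow(1)[OF assms] by simp
  with no have "v = i" by (auto elim: converse_rtranclE)
  ultimately show False
    using no p(2) by (metis not0_implies_Suc relpow_Suc_D2)
qed

subsection \<open>Polynomial maps and their roots\<close>

lemma mpoly_lookup_pos:
  assumes "mpoly_nonneg p" "m \<in> Poly_Mapping.keys p"
  shows "0 < Poly_Mapping.lookup p m"
  using assms by (metis in_keys_iff mpoly_nonneg_def order_le_less)

lemma mpoly_eval_mono:
  assumes "mpoly_nonneg p" "pos_vec x" "\<And>j. x $ j \<le> y $ j"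
  shows "mpoly_eval p x \<le> mpoly_eval p y"
  unfolding mpoly_eval_def using assms
  by (intro sum_mono mult_left_mono prod_mono conjI power_mono zero_le_power)
     (auto simp: mpoly_nonneg_def pos_vec_def less_imp_le)

lemma mpoly_eval_strict_mono:
  assumes p: "mpoly_nonneg p" and x: "pos_vec x" and le: "\<And>j. x $ j \<le> y $ j"
    and j: "j \<in> mpoly_vars p" and less: "x $ j < y $ j"
  shows "mpoly_eval p x < mpoly_eval p y"
proof -
  obtain m where m: "m \<in> Poly_Mapping.keys p" "j \<in> Poly_Mapping.keys m"
    using j by (auto simp: mpoly_vars_def)
  have x0: "0 < x $ i" and y0: "0 < y $ i" for i
    using x le[of i] by (auto simp: pos_vec_def intro: less_le_trans)
  have "(\<Prod>i\<in>UNIV. x $ i ^ Poly_Mapping.lookup m i) < (\<Prod>i\<in>UNIV. y $ i ^ Poly_Mapping.lookup m i)"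
  proof (rule prod_mono_strict)
    show "x $ j ^ Poly_Mapping.lookup m j < y $ j ^ Poly_Mapping.lookup m j"
      using m(2) less x0[of j] by (intro power_strict_mono) (auto simp: in_keys_iff)
  qed (use x0 y0 le in \<open>auto intro!: power_mono simp: less_imp_le\<close>)
  then have "Poly_Mapping.lookup p m * (\<Prod>i\<in>UNIV. x $ i ^ Poly_Mapping.lookup m i)
      < Poly_Mapping.lookup p m * (\<Prod>i\<in>UNIV. y $ i ^ Poly_Mapping.lookup m i)"
    using mpoly_lookup_pos[OF p m(1)] by simp
  moreover have "Poly_Mapping.lookup p m * (\<Prod>i\<in>UNIV. x $ i ^ Poly_Mapping.lookup m i)
      \<le> Poly_Mapping.lookup p m * (\<Prod>i\<in>UNIV. y $ i ^ Poly_Mapping.lookup m i)" for m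
    using p x0 le by (intro mult_left_mono prod_mono conjI power_mono zero_le_power)
      (auto simp: mpoly_nonneg_def less_imp_le)
  ultimately show ?thesis
    unfolding mpoly_eval_def using m(1) by (intro sum_strict_mono_ex1) auto
qed

lemma mpoly_eval_pos:
  assumes p: "mpoly_nonneg p" and x: "pos_vec x" and j: "j \<in> mpoly_vars p"
  shows "0 < mpoly_eval p x"
  unfolding mpoly_eval_def
proof (rule sum_pos)
  show "Poly_Mapping.keys p \<noteq> {}" using j by (auto simp: mpoly_vars_def)
qed (use x mpoly_lookup_pos[OF p] in \<open>auto intro!: mult_pos_pos prod_pos simp: pos_vec_def\<close>)

lemma mpoly_eval_scaleR:
  assumes "mpoly_homogeneous d p"
  shows "mpoly_eval p (c *\<^sub>R x) = c ^ d * mpoly_eval p x"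
proof -
  have "(\<Prod>j\<in>UNIV. (c *\<^sub>R x) $ j ^ Poly_Mapping.lookup m j)
      = c ^ d * (\<Prod>j\<in>UNIV. x $ j ^ Poly_Mapping.lookup m j)"
    if "m \<in> Poly_Mapping.keys p" for m
    using assms that
    by (auto simp: mpoly_homogeneous_def power_mult_distrib prod.distrib power_sum)
  then show ?thesis
    unfolding mpoly_eval_def sum_distrib_left by (intro sum.cong) auto
qed

text \<open>At a positive point the logarithmic derivative of a monomial is the sum of the
  logarithmic derivatives of its factors.\<close>

lemma has_derivative_mpoly_eval:
  assumes "pos_vec u"
  shows "(mpoly_eval p has_derivative
    (\<lambda>h. \<Sum>m\<in>Poly_Mapping.keys p. Poly_Mapping.lookup p m *
       ((\<Prod>j\<in>UNIV. u $ j ^ Poly_Mapping.lookup m j) *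
        (\<Sum>j\<in>UNIV. Poly_Mapping.lookup m j * (h $ j / u $ j))))) (at u)"
proof -
  have "((\<lambda>x. \<Prod>j\<in>UNIV. x $ j ^ Poly_Mapping.lookup m j) has_derivative
      (\<lambda>h. (\<Prod>j\<in>UNIV. u $ j ^ Poly_Mapping.lookup m j) *
        (\<Sum>j\<in>UNIV. Poly_Mapping.lookup m j * (h $ j / u $ j)))) (at u)" for m :: "'a \<Rightarrow>\<^sub>0 nat"
  proof -
    let ?l = "Poly_Mapping.lookup m"
    have "((\<lambda>x. \<Prod>j\<in>UNIV. x $ j ^ ?l j) has_derivative
        (\<lambda>h. \<Sum>j\<in>UNIV. (real (?l j) * h $ j * u $ j ^ (?l j - 1)) *
           (\<Prod>i\<in>UNIV - {j}. u $ i ^ ?l i))) (at u)"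
      by (intro has_derivative_prod has_derivative_power bounded_linear_imp_has_derivative
          bounded_linear_vec_nth)
    moreover have "(\<lambda>h. \<Sum>j\<in>UNIV. (real (?l j) * h $ j * u $ j ^ (?l j - 1)) *
          (\<Prod>i\<in>UNIV - {j}. u $ i ^ ?l i))
        = (\<lambda>h. (\<Prod>j\<in>UNIV. u $ j ^ ?l j) * (\<Sum>j\<in>UNIV. ?l j * (h $ j / u $ j)))"
    proof (rule ext, unfold sum_distrib_left, rule sum.cong[OF refl])
      fix h :: "real ^ 'a" and j
      have "(\<Prod>i\<in>UNIV. u $ i ^ ?l i) = u $ j ^ ?l j * (\<Prod>i\<in>UNIV - {j}. u $ i ^ ?l i)"
        by (rule prod.remove) auto
      moreover have "u $ j \<noteq> 0" using assms by (metis pos_vec_def less_irrefl)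
      ultimately show "(real (?l j) * h $ j * u $ j ^ (?l j - 1)) *
          (\<Prod>i\<in>UNIV - {j}. u $ i ^ ?l i)
          = (\<Prod>j\<in>UNIV. u $ j ^ ?l j) * (?l j * (h $ j / u $ j))"
        by (cases "?l j") (auto simp: field_simps)
    qed
    ultimately show ?thesis by simp
  qed
  then show ?thesis
    unfolding mpoly_eval_def[abs_def]
    by (intro has_derivative_sum has_derivative_mult_right)
qed

text \<open>Positivity of the \<open>P i\<close> at \<open>u\<close> keeps the root away from 0,
  where it has no derivative for d > 1.\<close>

lemma has_derivative_root_map:
  fixes P :: "'n::finite \<Rightarrow> 'n mpoly"
  assumes d: "d \<ge> 1" and u: "pos_vec u" and pos: "\<And>i. 0 < mpoly_eval (P i) u"
  shows "(root_map d P has_derivative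
    (\<lambda>h. \<chi> i. inverse (real d * root d (mpoly_eval (P i) u) ^ (d - 1)) *
      (\<Sum>m\<in>Poly_Mapping.keys (P i). Poly_Mapping.lookup (P i) m *
       ((\<Prod>j\<in>UNIV. u $ j ^ Poly_Mapping.lookup m j) *
        (\<Sum>j\<in>UNIV. Poly_Mapping.lookup m j * (h $ j / u $ j)))))) (at u)"
proof (subst has_derivative_componentwise_within, intro ballI)
  fix b :: "real ^ 'n" assume "b \<in> Basis"
  then obtain i where b: "b = axis i 1" by (auto simp: Basis_vec_def)
  have "DERIV (root d) (mpoly_eval (P i) u) :>
      inverse (real d * root d (mpoly_eval (P i) u) ^ (d - Suc 0))"
    using d pos by (intro DERIV_real_root) auto
  then show "((\<lambda>x. root_map d P x \<bullet> b) has_derivative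
    (\<lambda>h. (\<chi> i. inverse (real d * root d (mpoly_eval (P i) u) ^ (d - 1)) *
      (\<Sum>m\<in>Poly_Mapping.keys (P i). Poly_Mapping.lookup (P i) m *
       ((\<Prod>j\<in>UNIV. u $ j ^ Poly_Mapping.lookup m j) *
        (\<Sum>j\<in>UNIV. Poly_Mapping.lookup m j * (h $ j / u $ j))))) \<bullet> b)) (at u)"
    using has_derivative_compose[OF has_derivative_mpoly_eval[OF u, of "P i"], of "root d"]
    by (simp add: b inner_axis root_map_def has_field_derivative_def)
qed

text \<open>All weights in the derivative are positive at a positive point, so a variable that
  occurs in \<open>P i\<close> contributes a positive entry. The last claim is Euler's identity: the
  exponents of each monomial add up to d, which cancels the factor 1 / d from the root.\<close>

lemma jacobian_root_map:
  fixes P :: "'n::finite \<Rightarrow> 'n mpoly"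
  assumes d: "d \<ge> 1" and hom: "\<And>i. mpoly_homogeneous d (P i)" and nn: "\<And>i. mpoly_nonneg (P i)"
    and u: "pos_vec u" and pos: "\<And>i. 0 < mpoly_eval (P i) u"
  defines "M \<equiv> jacobian (root_map d P) (at u)"
  shows "(root_map d P has_derivative (*v) M) (at u)"
    and "0 \<le> M $ i $ j"
    and "(i, j) \<in> arc_rel P \<Longrightarrow> 0 < M $ i $ j"
    and "M *v u = root_map d P u"
proof -
  define \<kappa> where "\<kappa> i = inverse (real d * root d (mpoly_eval (P i) u) ^ (d - 1))" for i
  define w where "w i m = Poly_Mapping.lookup (P i) m * (\<Prod>j\<in>UNIV. u $ j ^ Poly_Mapping.lookup m j)"
    for i m
  let ?F' = "\<lambda>h. \<chi> i. \<kappa> i * (\<Sum>m\<in>Poly_Mapping.keys (P i). w i m *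
        (\<Sum>j\<in>UNIV. Poly_Mapping.lookup m j * (h $ j / u $ j)))"
  have D: "(root_map d P has_derivative ?F') (at u)"
    using has_derivative_root_map[OF d u pos] by (simp add: \<kappa>_def w_def mult.assoc)
  then show MD: "(root_map d P has_derivative (*v) M) (at u)"
    unfolding M_def using jacobian_works differentiable_def by blast
  then have F': "(*v) M = ?F'" using D has_derivative_unique by blast
  have M: "M $ i $ j = \<kappa> i * (\<Sum>m\<in>Poly_Mapping.keys (P i). w i m * (Poly_Mapping.lookup m j / u $ j))"
    for i j
  proof -
    have "M $ i $ j = (M *v axis j 1) $ i" by (simp add: matrix_vector_mult_basis column_def)
    also have "\<dots> = ?F' (axis j 1) $ i" by (simp only: F')
    finally show ?thesis
      by (simp add: axis_def if_distrib[of "\<lambda>x. x / _"] if_distrib[of "(*) _"] cong: if_cong)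
  qed
  have \<kappa>: "0 < \<kappa> i" for i using d pos[of i] by (simp add: \<kappa>_def)
  have w: "0 < w i m" if "m \<in> Poly_Mapping.keys (P i)" for i m
    using u mpoly_lookup_pos[OF nn that] by (auto simp: w_def pos_vec_def intro!: mult_pos_pos prod_pos)
  have u0: "0 < u $ j" for j using u by (simp add: pos_vec_def)
  have t: "0 \<le> w i m * (Poly_Mapping.lookup m j / u $ j)" if "m \<in> Poly_Mapping.keys (P i)" for i j m
    using w[OF that] u0[of j] by simp
  show "0 \<le> M $ i $ j"
    unfolding M using \<kappa>[of i] by (intro mult_nonneg_nonneg[of "\<kappa> i"] sum_nonneg t) auto
  show "0 < M $ i $ j" if arc: "(i, j) \<in> arc_rel P"
  proof -
    obtain m where m: "m \<in> Poly_Mapping.keys (P i)" "j \<in> Poly_Mapping.keys m"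
      using arc by (auto simp: mpoly_vars_def arc_rel_def)
    then have "0 < w i m * (Poly_Mapping.lookup m j / u $ j)"
      using w[OF m(1)] u0[of j] by (auto simp: in_keys_iff)
    then show ?thesis
      unfolding M using \<kappa>[of i] t m(1) by (intro mult_pos_pos[of "\<kappa> i"] sum_pos2[of _ m]) auto
  qed
  show "M *v u = root_map d P u"
  proof (rule vec_eq_iff[THEN iffD2], rule allI)
    fix i
    let ?R = "root d (mpoly_eval (P i) u)"
    have "(M *v u) $ i = ?F' u $ i" by (simp only: F')
    also have "\<dots> = \<kappa> i * (\<Sum>m\<in>Poly_Mapping.keys (P i). w i m * d)"
    proof -
      have "(\<Sum>j\<in>UNIV. Poly_Mapping.lookup m j * (u $ j / u $ j)) = real d"
        if "m \<in> Poly_Mapping.keys (P i)" for m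
      proof -
        have "u $ j \<noteq> 0" for j using u0[of j] by simp
        then have "(\<Sum>j\<in>UNIV. Poly_Mapping.lookup m j * (u $ j / u $ j))
            = real (\<Sum>j\<in>UNIV. Poly_Mapping.lookup m j)" by simp
        also have "\<dots> = real d" using hom that by (metis mpoly_homogeneous_def)
        finally show ?thesis .
      qed
      then show ?thesis by simp
    qed
    also have "\<dots> = \<kappa> i * (d * mpoly_eval (P i) u)"
      by (simp add: mpoly_eval_def w_def sum_distrib_left mult.commute)
    also have "\<dots> = inverse (?R ^ (d - 1)) * mpoly_eval (P i) u"
      using d by (simp add: \<kappa>_def)
    also have "\<dots> = inverse (?R ^ (d - 1)) * ?R ^ d"
      using d pos[of i] by (simp add: real_root_pow_pos2 less_imp_le)
    also have "\<dots> = ?R"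
      using d pos[of i] by (cases d) (auto simp: field_simps)
    finally show "(M *v u) $ i = root_map d P u $ i" by (simp add: root_map_def)
  qed
qed

subsection \<open>Global convergence\<close>

text \<open>The multiple is the minimum of the quotients \<open>v $ j / u $ j\<close>, hence the
  largest one below \<open>v\<close>; i is where it is attained.\<close>

lemma pos_vec_lower_multiple:
  fixes u v :: "real ^ 'n::finite"
  assumes u: "pos_vec u"
  obtains c i where "\<And>j. c * u $ j \<le> v $ j" "v $ i = c * u $ i"
proof -
  let ?S = "range (\<lambda>j. v $ j / u $ j)"
  have "Min ?S \<in> ?S" by (rule Min_in) auto
  then obtain i where i: "Min ?S = v $ i / u $ i" by blast
  have u0: "0 < u $ j" for j using u by (simp add: pos_vec_def)
  have "Min ?S \<le> v $ j / u $ j" for j by (rule Min_le) auto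
  then have le: "v $ i / u $ i * u $ j \<le> v $ j" for j
    using u0[of j] by (metis i pos_le_divide_eq)
  have "v $ i = v $ i / u $ i * u $ i" using u0[of i] by simp
  with le show ?thesis using that by blast
qed

text \<open>Strictness is required only along an arc, from coordinate j to coordinate i. Iteration
  turns arcs into walks, and \<open>primitive\<close> then makes an increase in one coordinate felt
  in all.\<close>

locale primitive_map =
  fixes G :: "real ^ 'n \<Rightarrow> real ^ 'n::finite" and R :: "'n rel" and u :: "real ^ 'n"
  assumes mono: "pos_vec v \<Longrightarrow> (\<And>j. v $ j \<le> w $ j) \<Longrightarrow> G v $ i \<le> G w $ i"
    and strict_mono: "pos_vec v \<Longrightarrow> (\<And>j. v $ j \<le> w $ j) \<Longrightarrow> (i, j) \<in> R \<Longrightarrow>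
      v $ j < w $ j \<Longrightarrow> G v $ i < G w $ i"
    and homogeneous: "0 < c \<Longrightarrow> G (c *\<^sub>R v) = c *\<^sub>R G v"
    and continuous: "pos_vec v \<Longrightarrow> isCont G v"
    and pos_u: "pos_vec u" and fix_u: "G u = u"
    and primitive: "\<exists>m. \<forall>i j. (i, j) \<in> R ^^ m"
begin

lemma u0: "0 < u $ i"
  using pos_u by (simp add: pos_vec_def)

lemma pos_cu: "0 < c \<Longrightarrow> pos_vec (c *\<^sub>R u)"
  using u0 by (simp add: pos_vec_def)

lemma lower:
  assumes "0 < c" "\<And>j. c * u $ j \<le> v $ j"
  shows "c * u $ i \<le> (G ^^ n) v $ i"
proof (induction n arbitrary: i)
  case (Suc n)
  have "G (c *\<^sub>R u) $ i \<le> G ((G ^^ n) v) $ i"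
    using Suc assms(1) by (intro mono pos_cu) auto
  then show ?case using assms(1) by (simp add: homogeneous fix_u)
qed (use assms in simp)

lemma pos_iterate:
  assumes "pos_vec v"
  shows "pos_vec ((G ^^ n) v)"
proof -
  obtain c i where c: "\<And>j. c * u $ j \<le> v $ j" "v $ i = c * u $ i"
    using pos_vec_lower_multiple[OF pos_u] by blast
  have "0 < c" using assms c(2) u0[of i] by (metis pos_vec_def zero_less_mult_pos2)
  then show ?thesis using lower[OF _ c(1)] u0
    by (auto simp: pos_vec_def intro: less_le_trans[OF mult_pos_pos])
qed

lemma upper:
  assumes v: "pos_vec v" and c: "0 < c" "\<And>j. v $ j \<le> c * u $ j"
  shows "(G ^^ n) v $ i \<le> c * u $ i"
proof (induction n arbitrary: i)
  case (Suc n)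
  have "G ((G ^^ n) v) $ i \<le> G (c *\<^sub>R u) $ i"
    using Suc by (intro mono pos_iterate[OF v]) auto
  then show ?case using c(1) by (simp add: homogeneous fix_u)
qed (use c in simp)

text \<open>A strict excess over \<open>c u\<close> at j is passed back along a walk of length n,
  one arc for each application of \<open>G\<close>.\<close>

lemma lower_strict:
  assumes c: "0 < c" "\<And>j. c * u $ j \<le> v $ j" and j: "c * u $ j < v $ j"
  shows "(i, j) \<in> R ^^ n \<Longrightarrow> c * u $ i < (G ^^ n) v $ i"
proof (induction n arbitrary: i)
  case (Suc n)
  then obtain k where k: "(i, k) \<in> R" "(k, j) \<in> R ^^ n" by (meson relpow_Suc_D2)
  have "G (c *\<^sub>R u) $ i < G ((G ^^ n) v) $ i"
    using Suc.IH[OF k(2)] lower[OF c] by (intro strict_mono[OF _ _ k(1)] pos_cu c) auto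
  then show ?case using c(1) by (simp add: homogeneous fix_u)
qed (use j in simp)

lemma isCont_iterate:
  assumes "pos_vec v"
  shows "isCont (G ^^ n) v"
proof (induction n)
  case (Suc n)
  then have "isCont (\<lambda>v. G ((G ^^ n) v)) v"
    using continuous[OF pos_iterate[OF assms]] by (rule isCont_o2)
  then show ?case by (simp add: comp_def)
qed (simp add: id_def)

text \<open>Every accumulation point of the orbit is bounded below by \<open>a u\<close>, where \<open>a\<close> is the limit of the
  increasing sequence \<open>c k\<close> of the best lower multiples of \<open>u\<close>. If it were not equal to \<open>a u\<close>, a
  further iteration would, by primitivity, make all components larger than those of \<open>a u\<close>.\<close>

lemma iterates_converge:
  assumes v: "pos_vec v"
  shows "\<exists>a>0. (\<lambda>k. (G ^^ k) v) \<longlonglongrightarrow> a *\<^sub>R u"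
proof -
  define y where "y k = (G ^^ k) v" for k
  have y_add: "y (n + k) = (G ^^ n) (y k)" for n k by (simp add: y_def funpow_add)
  have ypos: "pos_vec (y k)" for k unfolding y_def by (rule pos_iterate[OF v])
  have "\<exists>c. (\<forall>j. c * u $ j \<le> y k $ j) \<and> (\<exists>i. y k $ i = c * u $ i)" for k
    using pos_vec_lower_multiple[OF pos_u, of "y k"] by metis
  then obtain c i where c: "\<And>k j. c k * u $ j \<le> y k $ j" and i: "\<And>k. y k $ i k = c k * u $ i k"
    by metis
  have c0: "0 < c k" for k
    using ypos[of k] i[of k] u0[of "i k"] by (metis pos_vec_def zero_less_mult_pos2)
  have best: "b \<le> c k" if "\<And>j. b * u $ j \<le> y k $ j" for b k
    using that[of "i k"] u0[of "i k"] by (simp add: i)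
  have inc: "incseq c"
  proof (rule incseq_SucI)
    fix k show "c k \<le> c (Suc k)"
      using lower[OF c0[of k] c, where n = 1] y_add[of 1 k] by (intro best) simp
  qed
  obtain C where C: "0 < C" "\<And>j. v $ j \<le> C * u $ j"
  proof -
    \<comment> \<open>An upper multiple of \<open>u\<close> comes from a lower multiple of
      \<open>v\<close>, with the roles exchanged; C is the inverse of b.\<close>
    obtain b i where b: "\<And>j. b * v $ j \<le> u $ j" "u $ i = b * v $ i"
      using pos_vec_lower_multiple[OF v, of u] by metis
    have "0 < b" using v b(2) u0[of i] by (metis pos_vec_def zero_less_mult_pos2)
    then show ?thesis using b(1) that[of "inverse b"] by (simp add: field_simps)
  qed
  have yC: "y k $ j \<le> C * u $ j" for k j unfolding y_def by (rule upper[OF v C])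
  have "c k \<le> C" for k
    using order_trans[OF c yC, of k "i k"] u0[of "i k"] by simp
  then obtain a where a: "c \<longlonglongrightarrow> a" "\<And>k. c k \<le> a"
    using incseq_convergent[OF inc] by metis
  have a0: "0 < a" using c0[of 0] a(2)[of 0] by simp
  have "bounded (range y)"
  proof (rule boundedI)
    fix w assume "w \<in> range y"
    then obtain k where w: "w = y k" by auto
    have "norm w \<le> (\<Sum>j\<in>UNIV. \<bar>w $ j\<bar>)" by (rule norm_le_l1_cart)
    also have "\<dots> \<le> (\<Sum>j\<in>UNIV. C * u $ j)"
      using ypos[of k] yC[of k] by (intro sum_mono) (simp add: w pos_vec_def less_imp_le)
    finally show "norm w \<le> (\<Sum>j\<in>UNIV. C * u $ j)" .
  qed
  then obtain l s where s: "strict_mono s" and l: "(y \<circ> s) \<longlonglongrightarrow> l"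
    using bounded_imp_convergent_subsequence by blast
  have lj: "(\<lambda>k. y (s k) $ j) \<longlonglongrightarrow> l $ j" for j
    using tendsto_vec_nth[OF l] by (simp add: comp_def)
  have cs: "(\<lambda>k. c (s k)) \<longlonglongrightarrow> a"
    using LIMSEQ_subseq_LIMSEQ[OF a(1) s] by (simp add: comp_def)
  have al: "a * u $ j \<le> l $ j" for j
    by (rule LIMSEQ_le[OF tendsto_mult_right[OF cs] lj]) (use c in auto)
  have lpos: "pos_vec l"
    using al a0 u0 by (auto simp: pos_vec_def intro: less_le_trans[OF mult_pos_pos])
  have l_eq: "l $ j = a * u $ j" for j
  proof (rule ccontr)
    assume "l $ j \<noteq> a * u $ j"
    then have less: "a * u $ j < l $ j" using al[of j] by simp
    obtain m where m: "\<forall>i j. (i, j) \<in> R ^^ m" using primitive by blast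
    have gt: "a * u $ i < (G ^^ m) l $ i" for i
      using lower_strict[OF a0 al less] m by blast
    obtain b i where b: "\<And>j. b * u $ j \<le> (G ^^ m) l $ j" "(G ^^ m) l $ i = b * u $ i"
      using pos_vec_lower_multiple[OF pos_u] by blast
    have "a < b" using gt[of i] u0[of i] by (simp add: b(2))
    \<comment> \<open>The room between b' and b lets the strict inequality pass from the limit l to
      orbit points near it. Some later \<open>c\<close> is then at least b', beyond the limit
      a.\<close>
    then obtain b' where b': "a < b'" "b' < b" using dense by blast
    have "b' * u $ j < (G ^^ m) l $ j" for j
      using b(1)[of j] mult_strict_right_mono[OF b'(2) u0[of j]] by simp
    moreover have "(\<lambda>k. (G ^^ m) (y (s k))) \<longlonglongrightarrow> (G ^^ m) l"
      using isCont_tendsto_compose[OF isCont_iterate[OF lpos] l] by (simp add: comp_def)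
    ultimately have "eventually (\<lambda>k. b' * u $ j < (G ^^ m) (y (s k)) $ j) sequentially" for j
      using order_tendstoD(1)[OF tendsto_vec_nth] by blast
    then have "eventually (\<lambda>k. \<forall>j. b' * u $ j < (G ^^ m) (y (s k)) $ j) sequentially"
      by (rule eventually_all_finite)
    then obtain k where "\<And>j. b' * u $ j < (G ^^ m) (y (s k)) $ j"
      using eventually_happens'[OF sequentially_bot] by blast
    then have "b' \<le> c (m + s k)" by (intro best) (simp add: y_add less_imp_le)
    then show False using a(2)[of "m + s k"] b'(1) by simp
  qed
  \<comment> \<open>So far only a subsequence converges. The whole orbit is bounded below by
    \<open>c k\<close> times \<open>u\<close>; from above, once one member of the subsequence lies
    below b' times \<open>u\<close>, \<open>upper\<close> keeps all later iterates there.\<close>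
  have "(\<lambda>k. y k $ j) \<longlonglongrightarrow> a * u $ j" for j
  proof (rule order_tendstoI)
    fix b assume "b < a * u $ j"
    then have "eventually (\<lambda>k. b < c k * u $ j) sequentially"
      using order_tendstoD(1)[OF tendsto_mult_right[OF a(1), of "u $ j"]] by simp
    then show "eventually (\<lambda>k. b < y k $ j) sequentially"
      by eventually_elim (use c less_le_trans in blast)
  next
    fix b assume b: "a * u $ j < b"
    then have "a < b / u $ j" using u0[of j] by (simp add: pos_less_divide_eq)
    then obtain b' where b': "a < b'" "b' < b / u $ j" using dense by blast
    then have b'j: "b' * u $ j < b" using u0[of j] by (simp add: pos_less_divide_eq)
    have "l $ i < b' * u $ i" for i using b'(1) u0[of i] by (simp add: l_eq)
    then have "eventually (\<lambda>k. y (s k) $ i < b' * u $ i) sequentially" for i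
      using order_tendstoD(2)[OF lj] by blast
    then have "eventually (\<lambda>k. \<forall>i. y (s k) $ i < b' * u $ i) sequentially"
      by (rule eventually_all_finite)
    then obtain k where k: "\<And>i. y (s k) $ i < b' * u $ i"
      using eventually_happens'[OF sequentially_bot] by blast
    have "y n $ j < b" if "n \<ge> s k" for n
    proof -
      have "(G ^^ (n - s k)) (y (s k)) $ j \<le> b' * u $ j"
        using k b'(1) a0 by (intro upper ypos) (auto simp: less_imp_le)
      then show ?thesis using y_add[of "n - s k" "s k"] that b'j by simp
    qed
    then show "eventually (\<lambda>k. y k $ j < b) sequentially"
      unfolding eventually_sequentially by blast
  qed
  then have "y \<longlonglongrightarrow> a *\<^sub>R u" by (intro vec_tendstoI) simp
  then show ?thesis using a0 unfolding y_def[abs_def] by blast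
qed

end

subsection \<open>Growth of powers of a complex endomorphism\<close>

text \<open>Linear dependence is a notion for sets, so a repetition in the sequence is treated
  apart, with coefficients 1 and -1.\<close>

lemma euclidean_sequence_dependent:
  fixes f :: "nat \<Rightarrow> 'a::euclidean_space"
  shows "\<exists>c. (\<exists>i\<le>DIM('a). c i \<noteq> 0) \<and> (\<Sum>i\<le>DIM('a). c i *\<^sub>R f i) = 0"
proof (cases "inj_on f {..DIM('a)}")
  case True
  let ?S = "f ` {..DIM('a)}"
  have "dependent ?S" using True by (intro dependent_biggerset) (simp add: card_image)
  then obtain a where a: "\<exists>v\<in>?S. a v \<noteq> 0" "(\<Sum>v\<in>?S. a v *\<^sub>R v) = 0"
    by (auto simp: real_vector.dependent_finite)
  then show ?thesis using True by (intro exI[of _ "a \<circ> f"]) (auto simp: sum.reindex)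
next
  case False
  then obtain i j where ij: "i \<le> DIM('a)" "j \<le> DIM('a)" "i \<noteq> j" "f i = f j"
    by (auto simp: inj_on_def)
  let ?c = "\<lambda>k. if k = i then 1 else if k = j then - 1 else 0 :: real"
  have "(\<Sum>k\<le>DIM('a). ?c k *\<^sub>R f k)
      = (\<Sum>k\<le>DIM('a). (if k = i then f i else 0) - (if k = j then f j else 0))"
    using ij by (intro sum.cong) auto
  also have "\<dots> = 0" using ij by (simp add: sum_subtractf)
  finally show ?thesis using ij by (intro exI[of _ ?c]) auto
qed

lemma norm_vector_smult: "norm (c *s v) = cmod c * norm v" for v :: "complex ^ 'n"
proof -
  have "norm (c *s v) = L2_set (\<lambda>i. cmod c * norm (v $ i)) UNIV"
    by (simp add: norm_vec_def norm_mult)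
  then show ?thesis by (simp add: norm_vec_def L2_set_right_distrib)
qed

locale complex_endomorphism =
  fixes g :: "complex ^ 'n \<Rightarrow> complex ^ 'n::finite"
  assumes add: "g (v + w) = g v + g w" and smult: "g (c *s v) = c *s g v"
begin

lemma zero: "g 0 = 0"
  using smult[of 0 0] by simp

lemma pow_add: "(g ^^ k) (v + w) = (g ^^ k) v + (g ^^ k) w"
  by (induction k) (auto simp: add)

lemma pow_smult: "(g ^^ k) (c *s v) = c *s (g ^^ k) v"
  by (induction k) (auto simp: smult)

lemma pow_zero: "(g ^^ k) 0 = 0"
  by (induction k) (auto simp: zero)

lemma pow_sum: "finite A \<Longrightarrow> (g ^^ k) (\<Sum>a\<in>A. f a) = (\<Sum>a\<in>A. (g ^^ k) (f a))"
  by (induction A rule: finite_induct) (auto simp: pow_zero pow_add)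

text \<open>This is p(g) applied to v: the space as a module over polynomials, with X acting as
  \<open>g\<close>.\<close>

definition act :: "complex poly \<Rightarrow> complex ^ 'n \<Rightarrow> complex ^ 'n" where
  "act p v = (\<Sum>i\<le>degree p. coeff p i *s (g ^^ i) v)"

lemma act_bound:
  assumes "degree p \<le> n"
  shows "act p v = (\<Sum>i\<le>n. coeff p i *s (g ^^ i) v)"
  unfolding act_def using assms
  by (intro sum.mono_neutral_left) (auto simp: coeff_eq_0)

lemma act_add: "act p (v + w) = act p v + act p w"
  by (simp add: act_def pow_add vector_add_ldistrib sum.distrib)

lemma act_smult: "act p (c *s v) = c *s act p v"
  by (simp add: act_def pow_smult vec.scale_sum_right mult.commute)

lemma act_zero: "act p 0 = 0"
  by (simp add: act_def pow_zero)

lemma act_sum: "finite A \<Longrightarrow> act p (\<Sum>a\<in>A. f a) = (\<Sum>a\<in>A. act p (f a))"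
  by (induction A rule: finite_induct) (auto simp: act_zero act_add)

lemma act_apply: "act p (g v) = g (act p v)"
proof -
  have "g (\<Sum>i\<in>A. f i) = (\<Sum>i\<in>A. g (f i))" if "finite A" for A :: "nat set" and f
    using pow_sum[OF that, of 1 f] by simp
  then show ?thesis by (simp add: act_def smult funpow_swap1)
qed

text \<open>Multiplication by X shifts the coefficients, which amounts to applying \<open>g\<close>
  once more. This case of multiplicativity lets one root of an annihilating polynomial be split
  off.\<close>

lemma act_mult_linear: "act ([:- z, 1:] * p) v = act p (g v) - z *s act p v"
proof -
  let ?n = "Suc (degree p)"
  have "degree ([:- z, 1:] * p) \<le> ?n"
    by (rule order_trans[OF degree_mult_le]) simp
  then have "act ([:- z, 1:] * p) v = (\<Sum>i\<le>?n. coeff ([:- z, 1:] * p) i *s (g ^^ i) v)"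
    by (rule act_bound)
  also have "\<dots> = (\<Sum>i\<le>?n. coeff (pCons 0 p) i *s (g ^^ i) v) - (\<Sum>i\<le>?n. z *s (coeff p i *s (g ^^ i) v))"
    by (simp add: sum_subtractf[symmetric] vector_sub_rdistrib mult.commute del: sum.atMost_Suc)
  also have "(\<Sum>i\<le>?n. coeff (pCons 0 p) i *s (g ^^ i) v) = act p (g v)"
    by (subst sum.atMost_Suc_shift) (simp add: act_def funpow_swap1)
  also have "(\<Sum>i\<le>?n. z *s (coeff p i *s (g ^^ i) v)) = z *s act p v"
    by (subst act_bound[of p ?n]) (auto simp: vec.scale_sum_right)
  finally show ?thesis .
qed

lemma act_eigenvector:
  assumes "g v = z *s v"
  shows "act p v = poly p z *s v"
proof -
  have "(g ^^ i) v = z ^ i *s v" for i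
    by (induction i) (auto simp: smult assms mult.commute)
  then show ?thesis by (simp add: act_def poly_altdef vec.scale_sum_left)
qed

text \<open>The powers of \<open>g\<close> live in a space of finite dimension, so sufficiently many
  are dependent. The matrix \<open>f i\<close> stores the images of the basis vectors under the i-th
  power. N is a real dimension, hence the relation has real coefficients.\<close>

lemma annihilating_poly: "\<exists>p. p \<noteq> 0 \<and> (\<forall>v. act p v = 0)"
proof -
  define f :: "nat \<Rightarrow> complex ^ 'n ^ 'n" where "f i = (\<chi> a. (g ^^ i) (axis a 1))" for i
  define N where "N = DIM(complex ^ 'n ^ 'n)"
  obtain c where c: "\<exists>i\<le>N. c i \<noteq> 0" "(\<Sum>i\<le>N. c i *\<^sub>R f i) = 0"
    unfolding N_def using euclidean_sequence_dependent[of f] by blast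
  define p where "p = (\<Sum>i\<le>N. monom (complex_of_real (c i)) i)"
  have coeff: "coeff p i = (if i \<le> N then of_real (c i) else 0)" for i
    by (simp add: p_def coeff_sum coeff_monom)
  then have deg: "degree p \<le> N" by (intro degree_le) auto
  have ax: "act p (axis a 1) = 0" for a
  proof -
    have "act p (axis a 1) = (\<Sum>i\<le>N. coeff p i *s (g ^^ i) (axis a 1))"
      using deg by (rule act_bound)
    also have "\<dots> = (\<Sum>i\<le>N. c i *\<^sub>R f i) $ a"
      by (simp add: coeff f_def vec_eq_iff) (simp add: scaleR_conv_of_real)
    finally show ?thesis using c(2) by simp
  qed
  have "act p v = 0" for v
  proof -
    have "act p v = act p (\<Sum>a\<in>UNIV. v $ a *s axis a 1)" by (simp add: basis_expansion)
    also have "\<dots> = 0" by (simp add: act_sum act_smult ax)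
    finally show ?thesis .
  qed
  moreover have "p \<noteq> 0"
  proof -
    obtain i where "i \<le> N" "c i \<noteq> 0" using c(1) by blast
    then have "coeff p i \<noteq> 0" by (simp add: coeff)
    then show ?thesis by auto
  qed
  ultimately show ?thesis by blast
qed

text \<open>Every eigenvalue is a root of an annihilating polynomial. Finiteness makes the
  \<open>Max\<close> in \<open>max_modulus_except\<close> meaningful.\<close>

lemma finite_eigenvalues: "finite {z. \<exists>v. v \<noteq> 0 \<and> g v = z *s v}"
proof -
  obtain p where p: "p \<noteq> 0" "\<And>v. act p v = 0" using annihilating_poly by blast
  have "{z. \<exists>v. v \<noteq> 0 \<and> g v = z *s v} \<subseteq> {z. poly p z = 0}"
    using act_eigenvector[of _ _ p] p(2) by auto
  then show ?thesis using poly_roots_finite[OF p(1)] by (rule finite_subset)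
qed

text \<open>Write p = (X - z) p'. If p'(g) v is not zero, it is an eigenvector for z, so |z| < q.
  The vector v' = g v - z v is killed by p', and the orbit of v obeys a recursion with factor z and
  a forcing term of order \<open>q ^ k\<close>. Strictness of |z| < q keeps the growth at this
  order, where equality would bring in a factor k.\<close>

lemma orbit_bound:
  assumes ev: "\<And>z w. w \<noteq> 0 \<Longrightarrow> g w = z *s w \<Longrightarrow> cmod z < q" and q: "0 < q"
    and p: "p \<noteq> 0" "act p v = 0"
  shows "\<exists>C\<ge>0. \<forall>k. norm ((g ^^ k) v) \<le> C * q ^ k"
  using p
proof (induction "degree p" arbitrary: p v)
  case 0
  then obtain a where a: "p = [:a:]" by (metis degree_eq_zeroE)
  then have "v = 0" using 0 by (auto simp: act_def)
  then show ?case using q by (auto simp: pow_zero)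
next
  case (Suc n)
  have "\<not> constant (poly p)" using Suc.hyps(2) by (simp add: constant_degree)
  then obtain z where "poly p z = 0" using fundamental_theorem_of_algebra by blast
  then obtain p' where p': "p = [:- z, 1:] * p'" by (auto simp: poly_eq_0_iff_dvd elim: dvdE)
  then have nz: "p' \<noteq> 0" using Suc.prems(1) by auto
  then have deg: "n = degree p'"
    using Suc.hyps(2) by (simp add: p' degree_mult_eq del: mult_pCons_left)
  show ?case
  proof (cases "act p' v = 0")
    case True
    show ?thesis by (rule Suc.hyps(1)[OF deg nz True])
  next
    case False
    have "act p' (g v) = z *s act p' v" using Suc.prems(2) p' by (simp add: act_mult_linear del: mult_pCons_left)
    then have z: "cmod z < q" using ev[OF False] by (simp add: act_apply)
    define v' where "v' = g v + (- z) *s v"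
    have "act p' v' = act p' (g v) + (- z) *s act p' v"
      unfolding v'_def by (simp only: act_add act_smult)
    also have "\<dots> = 0" using \<open>act p' (g v) = _\<close> by (simp add: vec_eq_iff)
    finally obtain C where C: "0 \<le> C" "\<And>k. norm ((g ^^ k) v') \<le> C * q ^ k"
      using Suc.hyps(1)[OF deg nz] by blast
    \<comment> \<open>D is chosen so that |z| D + C <= q D, which closes the recursion; the summand
      \<open>norm v\<close> takes care of k = 0.\<close>
    define D where "D = norm v + C / (q - cmod z)"
    have D: "C \<le> D * (q - cmod z)" using z by (simp add: D_def distrib_right)
    have D0: "0 \<le> D" using z C by (simp add: D_def)
    have "norm ((g ^^ k) v) \<le> D * q ^ k" for k
    proof (induction k)
      case 0
      then show ?case using z C by (simp add: D_def)
    next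
      case (Suc k)
      have "(g ^^ Suc k) v = (g ^^ k) (z *s v + v')"
        by (simp add: funpow_swap1 v'_def vec_eq_iff del: funpow.simps) (simp add: funpow_swap1)
      also have "\<dots> = z *s (g ^^ k) v + (g ^^ k) v'" by (simp add: pow_add pow_smult)
      finally have "norm ((g ^^ Suc k) v) \<le> cmod z * norm ((g ^^ k) v) + norm ((g ^^ k) v')"
        by (metis norm_triangle_ineq norm_vector_smult)
      also have "\<dots> \<le> cmod z * (D * q ^ k) + C * q ^ k"
        using Suc C by (intro add_mono mult_left_mono) auto
      also have "\<dots> \<le> cmod z * (D * q ^ k) + D * (q - cmod z) * q ^ k"
        using mult_right_mono[OF D, of "q ^ k"] q by simp
      also have "\<dots> = D * q ^ Suc k" by (simp add: algebra_simps)
      finally show ?case .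
    qed
    then show ?thesis using D0 by blast
  qed
qed

text \<open>The constant of an orbit depends on its starting vector; the constants of the basis
  vectors add up to one that serves all.\<close>

lemma power_bound:
  assumes ev: "\<And>z w. w \<noteq> 0 \<Longrightarrow> g w = z *s w \<Longrightarrow> cmod z < q" and q: "0 < q"
  shows "\<exists>C. \<forall>k v. norm ((g ^^ k) v) \<le> C * q ^ k * norm v"
proof -
  obtain p where p: "p \<noteq> 0" "\<And>v. act p v = 0" using annihilating_poly by blast
  have "\<exists>C\<ge>0. \<forall>k. norm ((g ^^ k) v) \<le> C * q ^ k" for v
    by (rule orbit_bound[OF ev q p])
  then obtain C where C: "\<And>v. 0 \<le> C v" "\<And>v k. norm ((g ^^ k) v) \<le> C v * q ^ k"
    by metis
  have "norm ((g ^^ k) v) \<le> (\<Sum>a\<in>UNIV. C (axis a 1)) * q ^ k * norm v" for k v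
  proof -
    have "(g ^^ k) v = (g ^^ k) (\<Sum>a\<in>UNIV. v $ a *s axis a 1)" by (simp add: basis_expansion)
    also have "\<dots> = (\<Sum>a\<in>UNIV. v $ a *s (g ^^ k) (axis a 1))"
      by (simp add: pow_sum pow_smult)
    also have "norm \<dots> \<le> (\<Sum>a\<in>UNIV. cmod (v $ a) * norm ((g ^^ k) (axis a 1)))"
      by (rule order_trans[OF norm_sum]) (simp add: norm_vector_smult)
    also have "\<dots> \<le> (\<Sum>a\<in>UNIV. norm v * (C (axis a 1) * q ^ k))"
      using C q by (intro sum_mono mult_mono Finite_Cartesian_Product.norm_nth_le) auto
    also have "\<dots> = (\<Sum>a\<in>UNIV. C (axis a 1)) * q ^ k * norm v"
      by (simp add: sum_distrib_right sum_distrib_left mult.assoc mult.commute mult.left_commute)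
    finally show ?thesis .
  qed
  then show ?thesis by blast
qed

end

subsection \<open>Spectrum of the normalized derivative\<close>

text \<open>The term with c is there to rule out a generalized eigenvector. Subtracting from v the
  largest multiple of \<open>u\<close> below it leaves w >= 0 with a zero at some i, where the
  equation reads (M w)_i = c u_i, so c >= 0; the same for -v gives c = 0. A zero of w then makes a
  sum of nonnegative terms vanish, so it spreads along arcs to every coordinate.\<close>

lemma perron_eigenvector:
  fixes M :: "real ^ 'n ^ 'n::finite"
  assumes nn: "\<And>i j. 0 \<le> M $ i $ j" and arc: "\<And>i j. (i, j) \<in> R \<Longrightarrow> 0 < M $ i $ j"
    and conn: "R\<^sup>* = UNIV" and u: "pos_vec u" "M *v u = \<mu> *\<^sub>R u" and v: "M *v v = \<mu> *\<^sub>R v + c *\<^sub>R u"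
  shows "c = 0" and "\<exists>s. v = s *\<^sub>R u"
proof -
  have u0: "0 < u $ i" for i using u by (simp add: pos_vec_def)
  have decomp: "\<exists>s i w. v = s *\<^sub>R u + w \<and> (\<forall>j. 0 \<le> w $ j) \<and> w $ i = 0 \<and> M *v w = \<mu> *\<^sub>R w + c *\<^sub>R u"
    if v: "M *v v = \<mu> *\<^sub>R v + c *\<^sub>R u" for v c
  proof -
    obtain s i where s: "\<And>j. s * u $ j \<le> v $ j" "v $ i = s * u $ i"
      using pos_vec_lower_multiple[OF u(1)] by blast
    have "M *v (v - s *\<^sub>R u) = \<mu> *\<^sub>R (v - s *\<^sub>R u) + c *\<^sub>R u"
      using u(2) v by (simp add: matrix_vector_mult_diff_distrib matrix_vector_mult_scaleR algebra_simps)
    with s show ?thesis by (intro exI[of _ s] exI[of _ i] exI[of _ "v - s *\<^sub>R u"]) auto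
  qed
  have c_nonneg: "0 \<le> c" if c: "M *v v = \<mu> *\<^sub>R v + c *\<^sub>R u" for v c
  proof -
    obtain i w where w: "\<forall>j. 0 \<le> w $ j" "w $ i = 0" "M *v w = \<mu> *\<^sub>R w + c *\<^sub>R u"
      using decomp[OF c] by blast
    have "0 \<le> (M *v w) $ i"
      unfolding matrix_vector_mult_def using w(1) nn by (auto intro: sum_nonneg)
    then have "0 \<le> c * u $ i" by (simp add: w)
    then show ?thesis using u0[of i] by (simp add: zero_le_mult_iff)
  qed
  have "M *v (- v) = \<mu> *\<^sub>R (- v) + (- c) *\<^sub>R u"
    using v by (simp add: vec_eq_iff matrix_vector_mult_def sum_negf)
  then show c: "c = 0" using c_nonneg[OF v] c_nonneg[of "- v" "- c"] by simp
  obtain s i w where w: "v = s *\<^sub>R u + w" "\<forall>j. 0 \<le> w $ j" "w $ i = 0" "M *v w = \<mu> *\<^sub>R w"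
    using decomp[OF v] c by auto
  have "w $ j = 0" for j
  proof -
    have "(i, j) \<in> R\<^sup>*" using conn by simp
    then show ?thesis
    proof (induction rule: rtrancl_induct)
      case (step j k)
      have "(\<Sum>k\<in>UNIV. M $ j $ k * w $ k) = (M *v w) $ j"
        by (simp add: matrix_vector_mult_def)
      also have "\<dots> = 0" using step w(4) by simp
      finally have "M $ j $ k * w $ k = 0"
        using w(2) nn by (subst (asm) sum_nonneg_eq_0_iff) auto
      then show ?case using arc[OF step(2)] by simp
    qed (use w in simp)
  qed
  then have "w = 0" by (simp add: vec_eq_iff)
  then show "\<exists>s. v = s *\<^sub>R u" using w(1) by auto
qed

definition cvec :: "real ^ 'n \<Rightarrow> complex ^ 'n" where
  "cvec v = (\<chi> i. complex_of_real (v $ i))"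

lemma cvec_nth [simp]: "cvec v $ i = complex_of_real (v $ i)"
  by (simp add: cvec_def)

lemma norm_cvec: "norm (cvec v) = norm v"
  by (simp add: norm_vec_def)

lemma map_matrix_mult_Re_Im:
  "(\<chi> i. Re ((map_matrix complex_of_real M *v v) $ i)) = M *v (\<chi> i. Re (v $ i))"
  "(\<chi> i. Im ((map_matrix complex_of_real M *v v) $ i)) = M *v (\<chi> i. Im (v $ i))"
  by (simp_all add: vec_eq_iff matrix_vector_mult_def map_matrix_def)

lemma map_matrix_mult_cvec: "map_matrix complex_of_real M *v cvec v = cvec (M *v v)"
  by (simp add: vec_eq_iff matrix_vector_mult_def map_matrix_def)

lemma perron_eigenvector_complex:
  fixes M :: "real ^ 'n ^ 'n::finite"
  assumes nn: "\<And>i j. 0 \<le> M $ i $ j" and arc: "\<And>i j. (i, j) \<in> R \<Longrightarrow> 0 < M $ i $ j"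
    and conn: "R\<^sup>* = UNIV" and u: "pos_vec u" "M *v u = \<mu> *\<^sub>R u"
    and v: "map_matrix complex_of_real M *v v = of_real \<mu> *s v + c *s cvec u"
  shows "c = 0" and "\<exists>s. v = s *s cvec u"
proof -
  note perron = perron_eigenvector[OF nn arc conn u]
  let ?Re = "\<chi> i. Re (v $ i)" and ?Im = "\<chi> i. Im (v $ i)"
  have re: "M *v ?Re = \<mu> *\<^sub>R ?Re + Re c *\<^sub>R u"
    unfolding map_matrix_mult_Re_Im[symmetric] v by (simp add: vec_eq_iff)
  have im: "M *v ?Im = \<mu> *\<^sub>R ?Im + Im c *\<^sub>R u"
    unfolding map_matrix_mult_Re_Im[symmetric] v by (simp add: vec_eq_iff)
  show "c = 0" using perron(1)[OF _ re] perron(1)[OF _ im] by (simp add: complex_eq_iff)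
  obtain s t where "?Re = s *\<^sub>R u" "?Im = t *\<^sub>R u"
    using perron(2)[OF _ re] perron(2)[OF _ im] by blast
  then have "v = Complex s t *s cvec u" by (simp add: vec_eq_iff complex_eq_iff)
  then show "\<exists>s. v = s *s cvec u" by blast
qed

lemma complex_endomorphism_matrix: "complex_endomorphism ((*v) A)"
  by unfold_locales (simp_all add: matrix_vector_right_distrib vector_scalar_commute)

lemma finite_complex_eigenvalues: "finite (complex_eigenvalues A)"
  unfolding complex_eigenvalues_def
  by (rule complex_endomorphism.finite_eigenvalues[OF complex_endomorphism_matrix])

lemma max_modulus_except_ge:
  assumes "z \<in> complex_eigenvalues A" "z \<noteq> of_real \<mu>"
  shows "cmod z \<le> max_modulus_except A \<mu>"
  unfolding max_modulus_except_def using assms finite_complex_eigenvalues by (intro Max_ge) auto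

lemma max_modulus_except_nonneg: "0 \<le> max_modulus_except A \<mu>"
  unfolding max_modulus_except_def using finite_complex_eigenvalues by (intro Max_ge) auto

definition normalized_derivative ::
  "real \<Rightarrow> real ^ 'n \<Rightarrow> real ^ 'n \<Rightarrow> real ^ 'n ^ 'n \<Rightarrow> real ^ 'n \<Rightarrow> real ^ 'n::finite" where
  "normalized_derivative \<mu> \<psi> u M h = inverse \<mu> *\<^sub>R (M *v h - (\<psi> \<bullet> (M *v h)) *\<^sub>R u)"

lemma has_derivative_normalized:
  assumes F: "(F has_derivative (*v) M) (at u)" and u: "F u = \<mu> *\<^sub>R u" "\<psi> \<bullet> u = 1" and \<mu>: "0 < \<mu>"
  shows "((\<lambda>x. inverse (\<psi> \<bullet> F x) *\<^sub>R F x) has_derivative normalized_derivative \<mu> \<psi> u M) (at u)"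
proof -
  have "((\<lambda>x. inverse (\<psi> \<bullet> F x) *\<^sub>R F x) has_derivative
      (\<lambda>h. inverse (\<psi> \<bullet> F u) *\<^sub>R (M *v h) +
        (- (inverse (\<psi> \<bullet> F u) * (\<psi> \<bullet> (M *v h)) * inverse (\<psi> \<bullet> F u))) *\<^sub>R F u)) (at u)"
    using u \<mu> by (intro has_derivative_scaleR[OF Deriv.has_derivative_inverse[OF _ has_derivative_inner_right[OF F]] F]) simp
  also have "(\<lambda>h. inverse (\<psi> \<bullet> F u) *\<^sub>R (M *v h) +
        (- (inverse (\<psi> \<bullet> F u) * (\<psi> \<bullet> (M *v h)) * inverse (\<psi> \<bullet> F u))) *\<^sub>R F u)
      = normalized_derivative \<mu> \<psi> u M"
    using u \<mu> by (auto simp: normalized_derivative_def fun_eq_iff algebra_simps)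
  finally show ?thesis .
qed

text \<open>An eigenvector of the normalized derivative is deflated to one of \<open>M\<close> by subtracting a multiple
  of \<open>u\<close>; this fails for the eigenvalue \<open>\<mu>\<close>, which is excluded because it is simple.\<close>

lemma normalized_derivative_power_bound:
  fixes M :: "real ^ 'n ^ 'n::finite"
  assumes nn: "\<And>i j. 0 \<le> M $ i $ j" and arc: "\<And>i j. (i, j) \<in> R \<Longrightarrow> 0 < M $ i $ j"
    and conn: "R\<^sup>* = UNIV" and u: "pos_vec u" "M *v u = \<mu> *\<^sub>R u" "\<psi> \<bullet> u = 1" and \<mu>: "0 < \<mu>"
    and q: "inverse \<mu> * max_modulus_except M \<mu> < q"
  shows "\<exists>C. \<forall>k v. norm ((normalized_derivative \<mu> \<psi> u M ^^ k) v) \<le> C * q ^ k * norm v"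
proof -
  let ?M = "map_matrix complex_of_real M"
  \<comment> \<open>The complex linear extension of the functional given by \<psi>, spelled out as a
    sum because \<open>\<bullet>\<close> is real valued on complex vectors.\<close>
  define \<sigma> where "\<sigma> v = (\<Sum>j\<in>UNIV. complex_of_real (\<psi> $ j) * v $ j)" for v
  have \<sigma>_add: "\<sigma> (v + w) = \<sigma> v + \<sigma> w" for v w
    by (simp add: \<sigma>_def distrib_left sum.distrib)
  have \<sigma>_smult: "\<sigma> (c *s v) = c * \<sigma> v" for c v
    by (simp add: \<sigma>_def sum_distrib_left mult_ac)
  have \<sigma>_cvec: "\<sigma> (cvec v) = of_real (\<psi> \<bullet> v)" for v
    by (simp add: \<sigma>_def inner_vec_def)
  define g where "g v = of_real (inverse \<mu>) *s (?M *v v + (- \<sigma> (?M *v v)) *s cvec u)" for v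
  interpret M: complex_endomorphism "(*v) ?M" by (rule complex_endomorphism_matrix)
  interpret g: complex_endomorphism g
    by unfold_locales
      (simp_all add: g_def M.add M.smult \<sigma>_add \<sigma>_smult vec_eq_iff algebra_simps)
  have g_cvec: "g (cvec v) = cvec (normalized_derivative \<mu> \<psi> u M v)" for v
    by (simp add: g_def map_matrix_mult_cvec \<sigma>_cvec normalized_derivative_def vec_eq_iff right_diff_distrib)
  have g_pow: "(g ^^ k) (cvec v) = cvec ((normalized_derivative \<mu> \<psi> u M ^^ k) v)" for k v
    by (induction k) (auto simp: g_cvec)
  have q0: "0 < q"
    using q \<mu> max_modulus_except_nonneg[of M \<mu>] by (auto intro: le_less_trans[rotated])
  have "cmod z < q" if w: "w \<noteq> 0" "g w = z *s w" for z w
  proof (cases "z = 0")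
    case False
    define t where "t = \<sigma> (?M *v w)"
    have gw: "?M *v w + (- t) *s cvec u = of_real \<mu> * z *s w"
    proof -
      have "of_real \<mu> *s g w = (of_real \<mu> * of_real (inverse \<mu>)) *s (?M *v w + (- t) *s cvec u)"
        by (simp add: g_def t_def)
      also have "\<dots> = ?M *v w + (- t) *s cvec u"
        using \<mu> by (simp flip: of_real_mult)
      finally show ?thesis using w(2) by simp
    qed
    have Mw: "?M *v w = of_real \<mu> * z *s w + t *s cvec u"
      using gw by (simp add: vec_eq_iff algebra_simps)
    \<comment> \<open>The image of \<open>g\<close> lies in the kernel of \<sigma>, so an
      eigenvector for z nonzero does too. As \<sigma> is 1 at \<open>u\<close>, it is no multiple of
      \<open>u\<close>.\<close>
    have "\<sigma> (?M *v w + (- t) *s cvec u) = 0"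
      by (simp only: \<sigma>_add \<sigma>_smult \<sigma>_cvec u t_def) simp
    then have \<sigma>w: "\<sigma> w = 0" using gw False \<mu> by (simp add: \<sigma>_smult)
    have not_u: "w \<noteq> s *s cvec u" for s
    proof
      assume *: "w = s *s cvec u"
      then have "s = 0" using \<sigma>w by (simp add: \<sigma>_smult \<sigma>_cvec u)
      then show False using w(1) * by simp
    qed
    have z1: "z \<noteq> 1"
    proof
      assume "z = 1"
      then show False
        using perron_eigenvector_complex(2)[OF nn arc conn u(1,2), of w t] Mw not_u by auto
    qed
    \<comment> \<open>Solved from the demand that w - s u be an eigenvector of the matrix for \<mu>
      z; z = 1 is the value at which this has no solution for t nonzero.\<close>
    define s where "s = t / (of_real \<mu> * (1 - z))"
    have s: "t = of_real \<mu> * s * (1 - z)" using z1 \<mu> by (simp add: s_def)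
    define w' where "w' = w + (- s) *s cvec u"
    have "?M *v w' = ?M *v w + (- s) *s cvec (\<mu> *\<^sub>R u)"
      by (simp only: w'_def M.add M.smult map_matrix_mult_cvec u)
    also have "\<dots> = of_real \<mu> * z *s w'"
      by (simp add: Mw s w'_def vec_eq_iff algebra_simps)
    finally have "?M *v w' = of_real \<mu> * z *s w'" .
    moreover have "w' \<noteq> 0" using not_u[of s] by (auto simp: w'_def vec_eq_iff)
    ultimately have "of_real \<mu> * z \<in> complex_eigenvalues M"
      unfolding complex_eigenvalues_def by blast
    then have "cmod (of_real \<mu> * z) \<le> max_modulus_except M \<mu>"
      using z1 \<mu> by (intro max_modulus_except_ge) auto
    then have "cmod z \<le> inverse \<mu> * max_modulus_except M \<mu>"
      using \<mu> by (simp add: norm_mult field_simps)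
    then show ?thesis using q by simp
  qed (use q0 in simp)
  then obtain C where C: "\<And>k v. norm ((g ^^ k) v) \<le> C * q ^ k * norm v"
    using g.power_bound[of q] q0 by blast
  have "norm ((normalized_derivative \<mu> \<psi> u M ^^ k) v) \<le> C * q ^ k * norm v" for k v
    using C[of k "cvec v"] by (simp add: g_pow norm_cvec)
  then show ?thesis by blast
qed

subsection \<open>Rate of convergence of a fixed point iteration\<close>

text \<open>The proof uses the adapted norm \<open>sup\<^sub>k \<parallel>B\<^sup>k v\<parallel> / q\<^sup>k\<close>, for which \<open>B\<close> is \<open>q\<close>-Lipschitz.\<close>

lemma fixpoint_iteration_rate:
  fixes T :: "'a::real_normed_vector \<Rightarrow> 'a"
  assumes D: "(T has_derivative B) (at u)" and fix_u: "T u = u"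
    and B: "\<And>k v. norm ((B ^^ k) v) \<le> C * q ^ k * norm v" and q: "0 < q" "q < q'"
    and x: "\<And>k. x (Suc k) = T (x k)" and lim: "x \<longlonglongrightarrow> u"
  shows "\<exists>D. \<forall>k. norm (x k - u) \<le> D * q' ^ k"
proof -
  define K where "K = max C 1"
  have K: "0 < K" "norm ((B ^^ k) v) / q ^ k \<le> K * norm v" for k v
  proof -
    show "0 < K" by (simp add: K_def)
    have "norm ((B ^^ k) v) \<le> C * q ^ k * norm v" by (rule B)
    also have "\<dots> \<le> K * q ^ k * norm v" using q by (intro mult_right_mono) (auto simp: K_def)
    finally show "norm ((B ^^ k) v) / q ^ k \<le> K * norm v"
      using q by (simp add: divide_le_eq mult_ac)
  qed
  define nrm where "nrm v = (SUP k. norm ((B ^^ k) v) / q ^ k)" for v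
  have bdd: "bdd_above (range (\<lambda>k. norm ((B ^^ k) v) / q ^ k))" for v
    using K(2) by (intro bdd_aboveI2)
  have nrm_ge: "norm ((B ^^ k) v) / q ^ k \<le> nrm v" for k v
    unfolding nrm_def by (rule cSUP_upper[OF UNIV_I bdd])
  have nrm_le: "nrm v \<le> K * norm v" for v
    unfolding nrm_def by (rule cSUP_least) (use K in auto)
  have norm_le: "norm v \<le> nrm v" for v using nrm_ge[where k = 0] by simp
  have lin: "linear B" using D by (simp add: has_derivative_linear)
  have pow_add: "(B ^^ k) (v + w) = (B ^^ k) v + (B ^^ k) w" for k v w
    by (induction k) (auto simp: linear_add[OF lin])
  have nrm_add: "nrm (v + w) \<le> nrm v + nrm w" for v w
  proof (unfold nrm_def[of "v + w"], rule cSUP_least)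
    fix k
    have "norm ((B ^^ k) (v + w)) / q ^ k \<le> norm ((B ^^ k) v) / q ^ k + norm ((B ^^ k) w) / q ^ k"
      using q by (simp add: pow_add add_divide_distrib[symmetric] divide_right_mono norm_triangle_ineq)
    then show "norm ((B ^^ k) (v + w)) / q ^ k \<le> nrm v + nrm w"
      using nrm_ge[of k v] nrm_ge[of k w] by linarith
  qed simp
  have nrm_B: "nrm (B v) \<le> q * nrm v" for v
  proof (unfold nrm_def[of "B v"], rule cSUP_least)
    fix k
    have "norm ((B ^^ k) (B v)) / q ^ k = q * (norm ((B ^^ Suc k) v) / q ^ Suc k)"
      using q by (simp add: funpow_swap1)
    also have "\<dots> \<le> q * nrm v" using q by (intro mult_left_mono nrm_ge) simp
    finally show "norm ((B ^^ k) (B v)) / q ^ k \<le> q * nrm v" .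
  qed simp
  \<comment> \<open>A linearization error of \<delta> in the original norm costs at most K \<delta>
    = q' - q in the adapted norm.\<close>
  define \<delta> where "\<delta> = (q' - q) / K"
  have "0 < \<delta>" using q K by (simp add: \<delta>_def)
  then obtain \<epsilon> where \<epsilon>: "0 < \<epsilon>"
      "\<And>y. norm (y - u) < \<epsilon> \<Longrightarrow> norm (T y - T u - B (y - u)) \<le> \<delta> * norm (y - u)"
    using D unfolding has_derivative_at_alt by blast
  obtain n where n: "\<And>k. k \<ge> n \<Longrightarrow> norm (x k - u) < \<epsilon>"
    using lim \<epsilon>(1) unfolding LIMSEQ_iff by blast
  have step: "nrm (x (Suc k) - u) \<le> q' * nrm (x k - u)" if "k \<ge> n" for k
  proof -
    define e where "e = x k - u"
    define h where "h = T (x k) - T u - B e"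
    have "x (Suc k) - u = B e + h" by (simp add: h_def x fix_u)
    then have "nrm (x (Suc k) - u) \<le> nrm (B e) + nrm h" by (simp add: nrm_add)
    also have "\<dots> \<le> q * nrm e + K * (\<delta> * norm e)"
      using nrm_B[of e] nrm_le[of h] \<epsilon>(2)[OF n[OF that]] K(1)
      by (intro add_mono) (auto simp: h_def e_def intro: order_trans mult_left_mono)
    also have "\<dots> \<le> q * nrm e + K * (\<delta> * nrm e)"
      using K(1) \<open>0 < \<delta>\<close> norm_le[of e] by auto
    also have "\<dots> = q' * nrm e" using K(1) by (simp add: \<delta>_def field_simps)
    finally show ?thesis by (simp add: e_def)
  qed
  have nrm0: "0 \<le> nrm v" for v using norm_le[of v] norm_ge_zero order_trans by blast
  \<comment> \<open>The rescaled error decreases from index n on; the sum of its first values also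
    covers the indices before n.\<close>
  define c where "c k = nrm (x k - u) / q' ^ k" for k
  have c0: "0 \<le> c k" for k using q nrm0 by (simp add: c_def)
  have dec: "c (Suc k) \<le> c k" if "k \<ge> n" for k
    using step[OF that] q by (simp add: c_def field_simps)
  have "c k \<le> c n" if "k \<ge> n" for k
    using that by (induction k rule: dec_induct) (auto intro: order_trans dec)
  moreover have "c k \<le> (\<Sum>i\<le>n. c i)" if "k \<le> n" for k
    using that c0 by (intro member_le_sum) auto
  ultimately have c_le: "c k \<le> (\<Sum>i\<le>n. c i)" for k
    by (metis nat_le_linear order_refl order_trans)
  have "norm (x k - u) \<le> (\<Sum>i\<le>n. c i) * q' ^ k" for k
  proof -
    have "norm (x k - u) \<le> c k * q' ^ k" using norm_le[of "x k - u"] q by (simp add: c_def)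
    also have "\<dots> \<le> (\<Sum>i\<le>n. c i) * q' ^ k" using c_le q by (intro mult_right_mono) auto
    finally show ?thesis .
  qed
  then show ?thesis by blast
qed

section \<open>From geometric error bounds to the limsup in an arbitrary norm\<close>

lemma limsup_root_le:
  fixes f :: "nat \<Rightarrow> real"
  assumes \<rho>: "0 \<le> \<rho>" and f: "\<And>q. \<rho> < q \<Longrightarrow> \<exists>D. \<forall>k. f k \<le> D * q ^ k"
  shows "limsup (\<lambda>k. ereal (root k (f k))) \<le> ereal \<rho>"
proof (rule ereal_le_epsilon2)
  fix e :: real assume e: "0 < e"
  define q where "q = \<rho> + e"
  have q: "\<rho> < q" "0 < q" using \<rho> e by (auto simp: q_def)
  obtain D where D: "\<And>k. f k \<le> D * q ^ k" using f[OF q(1)] by blast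
  \<comment> \<open>A positive constant, so that its k-th root tends to 1.\<close>
  define D' where "D' = max D 1"
  have D': "f k \<le> D' * q ^ k" for k
    using D[of k] q by (auto simp: D'_def intro: order_trans mult_right_mono)
  have "eventually (\<lambda>k. ereal (root k (f k)) \<le> ereal (root k D' * q)) sequentially"
    using eventually_gt_at_top[of 0]
  proof eventually_elim
    case (elim k)
    then have "root k (f k) \<le> root k (D' * q ^ k)" using D' by simp
    also have "\<dots> = root k D' * q" using elim q by (simp add: real_root_mult real_root_power_cancel)
    finally show ?case by simp
  qed
  then have "limsup (\<lambda>k. ereal (root k (f k))) \<le> limsup (\<lambda>k. ereal (root k D' * q))"
    by (rule Limsup_mono)
  also have "\<dots> = ereal q"
  proof (rule lim_imp_Limsup)
    have "(\<lambda>k. root k D' * q) \<longlonglongrightarrow> 1 * q"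
      by (intro tendsto_mult tendsto_const LIMSEQ_root_const) (simp add: D'_def)
    then show "(\<lambda>k. ereal (root k D' * q)) \<longlonglongrightarrow> ereal q" by simp
  qed simp
  finally show "limsup (\<lambda>k. ereal (root k (f k))) \<le> ereal \<rho> + ereal e" by (simp add: q_def)
qed

text \<open>The half of the equivalence of norms that carries upper bounds from the Euclidean norm
  over to \<open>N\<close>, by expansion in the basis.\<close>

lemma is_norm_bounded:
  fixes N :: "'a::euclidean_space \<Rightarrow> real"
  assumes "is_norm N"
  shows "\<exists>K\<ge>0. \<forall>v. N v \<le> K * norm v"
proof -
  have N: "0 \<le> N v" "N (c *\<^sub>R v) = \<bar>c\<bar> * N v" "N (v + w) \<le> N v + N w" "N 0 = 0" for c v w
    using assms by (auto simp: is_norm_def)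
  have sum: "N (\<Sum>a\<in>A. f a) \<le> (\<Sum>a\<in>A. N (f a))" if "finite A" for A :: "'a set" and f
    using that
  proof (induction A rule: finite_induct)
    case (insert a A)
    then show ?case using N(3)[of "f a" "\<Sum>a\<in>A. f a"] by simp
  qed (simp add: N)
  have "N v \<le> (\<Sum>b\<in>Basis. N b) * norm v" for v
  proof -
    have "N v = N (\<Sum>b\<in>Basis. (v \<bullet> b) *\<^sub>R b)" by (simp add: euclidean_representation)
    also have "\<dots> \<le> (\<Sum>b\<in>Basis. N ((v \<bullet> b) *\<^sub>R b))" by (rule sum) simp
    also have "\<dots> \<le> (\<Sum>b\<in>Basis. N b * norm v)"
      using N(1) Basis_le_norm[of _ v]
      by (intro sum_mono) (simp add: N(2) mult.commute[of _ "N _"] mult_left_mono)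
    finally show ?thesis by (simp add: sum_distrib_right)
  qed
  then show ?thesis using N(1) by (intro exI[of _ "\<Sum>b\<in>Basis. N b"]) (auto intro: sum_nonneg)
qed

subsection \<open>The power algorithm\<close>

theorem corollary5p2:
  fixes P :: "'n::finite \<Rightarrow> 'n mpoly"
    and d :: nat
    and \<psi> u :: "real ^ 'n"
    and lam \<mu> r :: real
    and M :: "real ^ 'n ^ 'n"
    and N :: "real ^ 'n \<Rightarrow> real"
    and x :: "nat \<Rightarrow> real ^ 'n"
  assumes "d \<ge> 1"
    and "\<And>i. mpoly_homogeneous d (P i)"
    and "\<And>i. mpoly_nonneg (P i)"
    and "weakly_primitive P"
    and "pos_vec \<psi>"
    and "pos_vec u"
    and "\<And>i. mpoly_eval (P i) u = lam * (u $ i) ^ d"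
    and "\<psi> \<bullet> u = 1"
    and "\<mu> = root d lam"
    and "M = jacobian (root_map d P) (at u)"
    and "r = max_modulus_except M \<mu>"
    and "is_norm N"
    and "pos_vec (x 0)"
    and "power_algorithm \<psi> (root_map d P) x"
  shows "limsup (\<lambda>k. ereal (root k (N (x k - u)))) \<le> ereal (inverse \<mu> * r)"
proof -
  let ?F = "root_map d P" and ?R = "arc_rel P"
  note d = assms(1) and hom = assms(2) and nn = assms(3) and prim = assms(4) and \<psi> = assms(5)
    and u = assms(6) and eq = assms(7) and \<psi>u = assms(8)
  have Ppos: "0 < mpoly_eval (P i) v" if "pos_vec v" for i v
  proof -
    obtain j where "j \<in> mpoly_vars (P i)"
      using weakly_primitive_has_arc[OF prim] by (auto simp: arc_rel_def)
    then show ?thesis using mpoly_eval_pos[OF nn that] by blast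
  qed
  have u0: "0 < u $ i" for i using u by (simp add: pos_vec_def)
  have "0 < lam"
  proof -
    fix i
    have "0 < lam * u $ i ^ d" using Ppos[OF u, of i] eq by simp
    then show ?thesis using u0[of i] by (simp add: zero_less_mult_iff)
  qed
  then have \<mu>: "0 < \<mu>" using assms(9) d by simp
  have Fu: "?F u = \<mu> *\<^sub>R u"
    using d u0 by (simp add: root_map_def vec_eq_iff eq assms(9) real_root_mult real_root_power_cancel less_imp_le)
  note J = jacobian_root_map[where P = P, OF d hom nn u Ppos[OF u], folded assms(10)]
  have Mu: "M *v u = \<mu> *\<^sub>R u" using J(4) Fu by simp
  have Fpos: "pos_vec (?F v)" if "pos_vec v" for v
    using Ppos[OF that] d by (simp add: pos_vec_def root_map_def)
  have Fhom: "?F (c *\<^sub>R v) = c *\<^sub>R ?F v" if "0 < c" for c v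
    using d that by (simp add: root_map_def vec_eq_iff mpoly_eval_scaleR[OF hom] real_root_mult
        real_root_power_cancel)
  define G where "G v = inverse \<mu> *\<^sub>R ?F v" for v
  interpret primitive_map G ?R u
  proof
    show "G v $ i \<le> G w $ i" if "pos_vec v" "\<And>j. v $ j \<le> w $ j" for v w i
      using mpoly_eval_mono[OF nn[of i] that] d \<mu> by (simp add: G_def root_map_def)
    show "G v $ i < G w $ i"
      if "pos_vec v" "\<And>j. v $ j \<le> w $ j" "(i, j) \<in> ?R" "v $ j < w $ j" for v w i j
      using mpoly_eval_strict_mono[OF nn[of i] that(1,2) _ that(4)] that(3) d \<mu>
      by (simp add: G_def root_map_def arc_rel_def)
    show "G (c *\<^sub>R v) = c *\<^sub>R G v" if "0 < c" for c v
      using Fhom[OF that] by (simp add: G_def)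
    show "isCont G v" if "pos_vec v" for v
    proof -
      \<comment> \<open>The derivative formula holds at every positive point, so it is applied at v
        in place of \<open>u\<close>.\<close>
      have "isCont ?F v"
        by (rule has_derivative_continuous[OF jacobian_root_map(1)[where P = P, OF d hom nn that Ppos[OF that]]])
      then show ?thesis unfolding G_def by (intro continuous_intros)
    qed
    show "G u = u" using Fu \<mu> by (simp add: G_def)
    show "\<exists>m. \<forall>i j. (i, j) \<in> ?R ^^ m" by (rule weakly_primitive_relpow(2)[OF prim])
  qed (rule u)
  have \<psi>pos: "0 < \<psi> \<bullet> v" if "pos_vec v" for v
    using \<psi> that by (auto simp: inner_vec_def pos_vec_def intro!: sum_pos)
  define T where "T v = inverse (\<psi> \<bullet> ?F v) *\<^sub>R ?F v" for v
  have x: "x (Suc k) = T (x k)" for k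
    using assms(14) by (simp add: power_algorithm_def T_def)
  \<comment> \<open>Homogeneity pulls all normalizing factors out of the map.\<close>
  have "\<exists>c>0. x k = c *\<^sub>R (G ^^ k) (x 0)" for k
  proof (induction k)
    case 0
    show ?case by (intro exI[of _ 1]) simp
  next
    case (Suc k)
    then obtain c where c: "0 < c" "x k = c *\<^sub>R (G ^^ k) (x 0)" by blast
    let ?y = "(G ^^ k) (x 0)"
    have "?F (x k) = c *\<^sub>R (\<mu> *\<^sub>R G ?y)" using c \<mu> Fhom by (simp add: G_def)
    then have "x (Suc k) = (inverse (\<psi> \<bullet> ?F (x k)) * c * \<mu>) *\<^sub>R (G ^^ Suc k) (x 0)"
      by (simp add: x T_def)
    moreover have "pos_vec (x k)"
      using c pos_iterate[OF assms(13), of k] by (simp add: pos_vec_def)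
    then have "0 < inverse (\<psi> \<bullet> ?F (x k)) * c * \<mu>"
      using \<psi>pos[OF Fpos] c \<mu> by simp
    ultimately show ?case by blast
  qed
  then obtain c where c: "\<And>k. 0 < c k" "\<And>k. x k = c k *\<^sub>R (G ^^ k) (x 0)" by metis
  obtain a where a: "0 < a" "(\<lambda>k. (G ^^ k) (x 0)) \<longlonglongrightarrow> a *\<^sub>R u"
    using iterates_converge[OF assms(13)] by blast
  have xpos: "pos_vec (x k)" for k
    unfolding c(2)[of k] using c(1)[of k] pos_iterate[OF assms(13), of k] by (simp add: pos_vec_def)
  \<comment> \<open>The factor is determined by \<open>\<psi> \<bullet> x (Suc k) = 1\<close>. The
    starting vector need not be normalized, so this begins at index 1.\<close>
  have "x (Suc k) = inverse (\<psi> \<bullet> (G ^^ Suc k) (x 0)) *\<^sub>R (G ^^ Suc k) (x 0)" for k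
  proof -
    have "\<psi> \<bullet> x (Suc k) = 1" using \<psi>pos[OF Fpos[OF xpos[of k]]] by (simp add: x T_def)
    then have "(\<psi> \<bullet> (G ^^ Suc k) (x 0)) * c (Suc k) = 1"
      unfolding c(2)[of "Suc k"] by (simp only: inner_scaleR_right mult.commute)
    then have "inverse (\<psi> \<bullet> (G ^^ Suc k) (x 0)) = c (Suc k)" by (rule inverse_unique)
    then show ?thesis using c(2)[of "Suc k"] by simp
  qed
  moreover have "(\<lambda>k. inverse (\<psi> \<bullet> (G ^^ Suc k) (x 0)) *\<^sub>R (G ^^ Suc k) (x 0))
      \<longlonglongrightarrow> inverse (\<psi> \<bullet> (a *\<^sub>R u)) *\<^sub>R (a *\<^sub>R u)"
    using a(1) \<psi>u by (intro tendsto_intros LIMSEQ_Suc[OF a(2)]) auto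
  ultimately have "(\<lambda>k. x (Suc k)) \<longlonglongrightarrow> u" using a(1) \<psi>u by simp
  then have lim: "x \<longlonglongrightarrow> u" by (rule LIMSEQ_imp_Suc)
  have DT: "(T has_derivative normalized_derivative \<mu> \<psi> u M) (at u)"
    unfolding T_def[abs_def] by (rule has_derivative_normalized[OF J(1) Fu \<psi>u \<mu>])
  have Tu: "T u = u" using \<mu> by (simp add: T_def Fu \<psi>u)
  obtain K where K: "0 \<le> K" "\<And>v. N v \<le> K * norm v" using is_norm_bounded[OF assms(12)] by blast
  have \<rho>: "0 \<le> inverse \<mu> * r"
    using \<mu> max_modulus_except_nonneg[of M \<mu>] by (simp add: assms(11))
  show ?thesis
  proof (rule limsup_root_le[OF \<rho>])
    fix q assume q: "inverse \<mu> * r < q"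
    \<comment> \<open>The excess over the rate is spent twice: q' bounds the powers of the
      derivative, and the gap up to q absorbs the nonlinear remainder.\<close>
    then obtain q' where q': "inverse \<mu> * r < q'" "q' < q" using dense by blast
    then obtain C where "\<And>k v. norm ((normalized_derivative \<mu> \<psi> u M ^^ k) v) \<le> C * q' ^ k * norm v"
      using normalized_derivative_power_bound[OF J(2,3) weakly_primitive_relpow(1)[OF prim] u Mu \<psi>u \<mu>]
      by (metis assms(11))
    then obtain D where D: "\<And>k. norm (x k - u) \<le> D * q ^ k"
      using fixpoint_iteration_rate[OF DT Tu _ _ q'(2) x lim] q'(1) \<rho> by (metis le_less_trans)
    have "N (x k - u) \<le> K * D * q ^ k" for k
      using order_trans[OF K(2) mult_left_mono[OF D K(1)], of k] by (simp add: mult.assoc)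
    then show "\<exists>D. \<forall>k. N (x k - u) \<le> D * q ^ k" by blast
  qed
qed

end
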